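(* Let $\{\phi_i\}_{i\in I}$ and $\{\psi_i\}_{i\in I}$ be two woven frames for $\mathcal H$. Then for any $\lambda\in\mathbb R$, $\sigma\subset I$ and $f\in\mathcal H$, $$\begin{aligned} &\Big(2\lambda-\frac{\lambda^2}{2}-1\Big)\sum_{i\in\sigma}|\langle f,\phi_i\rangle|^2+\Big(1-\frac{\lambda^2}{2}\Big)\sum_{i\in\sigma^c}|\langle f,\psi_i\rangle|^2\\ \le\ &\sum_{i\in\sigma}|\langle S_{\mathcal W}^{\sigma}f,S_{\mathcal W}^{-1}\phi_i\rangle|^2+\sum_{i\in\sigma^c}|\langle S_{\mathcal W}^{\sigma}f,S_{\mathcal W}^{-1}\psi_i\rangle|^2+\sum_{i\in\sigma}|\langle S_{\mathcal W}^{\sigma^c}f,S_{\mathcal W}^{-1}\phi_i\rangle|^2+\sum_{i\in\sigma^c}|\langle S_{\mathcal W}^{\sigma^c}f,S_{\mathcal W}^{-1}\psi_i\rangle|^2\\ \le\ &\sum_{i\in\sigma}|\langle f,\phi_i\rangle|^2+\sum_{i\in\sigma^c}|\langle f,\psi_i\rangle|^2 . \end{aligned}$$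
   Context: $\mathcal H$ is a separable Hilbert space, $I$ is a countable index set, and for $\sigma\subset I$ one writes $\sigma^c=I\setminus\sigma$. A family $\{\phi_i\}_{i\in I}$ in $\mathcal H$ is a frame with lower and upper frame bounds $A,B>0$ if $A\|f\|^2\le\sum_{i\in I}|\langle f,\phi_i\rangle|^2\le B\|f\|^2$ for all $f\in\mathcal H$. Two frames $\{\phi_i\}_{i\in I}$ and $\{\psi_i\}_{i\in I}$ for $\mathcal H$ are woven if there are universal constants $A,B>0$ such that for every $\sigma\subset I$ the family $\{\phi_i\}_{i\in\sigma}\cup\{\psi_i\}_{i\in\sigma^c}$ (called a weaving) is a frame for $\mathcal H$ with lower and upper bounds $A$ and $B$. For given $\sigma\subset I$, define bounded linear operators on $\mathcal H$ by $S_{\mathcal W}^{\sigma}f=\sum_{i\in\sigma}\langle f,\phi_i\rangle\phi_i$, $S_{\mathcal W}^{\sigma^c}f=\sum_{i\in\sigma^c}\langle f,\psi_i\rangle\psi_i$, and $S_{\mathcal W}=S_{\mathcal W}^{\sigma}+S_{\mathcal W}^{\sigma^c}$; $S_{\mathcal W}$ is the frame operator of the weaving (it depends on $\sigma$), and it is bounded, invertible, self-adjoint and positive. *)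

theory Defs
  imports "HOL-Analysis.Analysis"
begin

text \<open>
  Scalars of a Hilbert space: the real or the complex numbers. The axioms admit no other fields,
  since a real normed field (with multiplicative norm) is isomorphic to one of these two, and the
  last axiom determines the conjugation.
\<close>

class rc_field = real_normed_field +
  fixes conjg :: "'a \<Rightarrow> 'a"
  assumes conjg_add: "conjg (x + y) = conjg x + conjg y"
    and conjg_mult: "conjg (x * y) = conjg x * conjg y"
    and mult_conjg: "x * conjg x = ((norm x)\<^sup>2) *\<^sub>R 1"

instantiation real :: rc_field
begin
definition conjg_real :: "real \<Rightarrow> real" where "conjg_real x = x"
instance by standard (simp_all add: conjg_real_def power2_eq_square)
end

instantiation complex :: rc_field
begin
definition conjg_complex :: "complex \<Rightarrow> complex" where "conjg_complex x = cnj x"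
instance
  by standard (simp_all add: conjg_complex_def scaleR_conv_of_real flip: complex_norm_square)
end

text \<open>
  The inner product is linear in the first argument. Completeness is part of the sort
  \<open>banach\<close>, and definiteness follows from \<open>ip_self\<close>.
\<close>

locale separable_hilbert_space = vector_space smul
  for smul :: "'k::rc_field \<Rightarrow> 'a::banach \<Rightarrow> 'a" +
  fixes ip :: "'a \<Rightarrow> 'a \<Rightarrow> 'k"
  assumes scale_of_real: "smul (of_real r) x = r *\<^sub>R x"
    and ip_add_left: "ip (x + y) z = ip x z + ip y z"
    and ip_scale_left: "ip (smul c x) y = c * ip x y"
    and ip_conjg: "ip y x = conjg (ip x y)"
    and ip_self: "ip x x = of_real ((norm x)\<^sup>2)"
    and separable: "\<exists>D::'a set. countable D \<and> closure D = UNIV"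

text \<open>
  Since \<open>infsum\<close> is \<open>0\<close> on divergent families, the finiteness implicit in the upper frame
  inequality is stated as summability.
\<close>

definition frame_with_bounds ::
    "('a::real_normed_vector \<Rightarrow> 'a \<Rightarrow> 'k::real_normed_field) \<Rightarrow> 'i set \<Rightarrow> ('i \<Rightarrow> 'a) \<Rightarrow> real \<Rightarrow> real \<Rightarrow> bool"
  where "frame_with_bounds ip I \<phi> A B \<longleftrightarrow> A > 0 \<and> B > 0 \<and>
    (\<forall>f. (\<lambda>i. (norm (ip f (\<phi> i)))\<^sup>2) summable_on I \<and>
         A * (norm f)\<^sup>2 \<le> (\<Sum>\<^sub>\<infinity>i\<in>I. (norm (ip f (\<phi> i)))\<^sup>2) \<and>
         (\<Sum>\<^sub>\<infinity>i\<in>I. (norm (ip f (\<phi> i)))\<^sup>2) \<le> B * (norm f)\<^sup>2)"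

definition frame ::
    "('a::real_normed_vector \<Rightarrow> 'a \<Rightarrow> 'k::real_normed_field) \<Rightarrow> 'i set \<Rightarrow> ('i \<Rightarrow> 'a) \<Rightarrow> bool"
  where "frame ip I \<phi> \<longleftrightarrow> (\<exists>A B. frame_with_bounds ip I \<phi> A B)"

definition weaving :: "'i set \<Rightarrow> ('i \<Rightarrow> 'a) \<Rightarrow> ('i \<Rightarrow> 'a) \<Rightarrow> 'i \<Rightarrow> 'a"
  where "weaving \<sigma> \<phi> \<psi> i = (if i \<in> \<sigma> then \<phi> i else \<psi> i)"

definition woven_frames ::
    "('a::real_normed_vector \<Rightarrow> 'a \<Rightarrow> 'k::real_normed_field) \<Rightarrow> 'i set \<Rightarrow> ('i \<Rightarrow> 'a) \<Rightarrow> ('i \<Rightarrow> 'a) \<Rightarrow> bool"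
  where "woven_frames ip I \<phi> \<psi> \<longleftrightarrow> frame ip I \<phi> \<and> frame ip I \<psi> \<and>
    (\<exists>A B. A > 0 \<and> B > 0 \<and> (\<forall>\<sigma>\<subseteq>I. frame_with_bounds ip I (weaving \<sigma> \<phi> \<psi>) A B))"

definition partial_frame_op ::
    "('k \<Rightarrow> 'a \<Rightarrow> 'a) \<Rightarrow> ('a::real_normed_vector \<Rightarrow> 'a \<Rightarrow> 'k::real_normed_field) \<Rightarrow> 'i set \<Rightarrow> ('i \<Rightarrow> 'a) \<Rightarrow> 'a \<Rightarrow> 'a"
  where "partial_frame_op smul ip J \<phi> f = (\<Sum>\<^sub>\<infinity>i\<in>J. smul (ip f (\<phi> i)) (\<phi> i))"

definition weaving_frame_op ::
    "('k \<Rightarrow> 'a \<Rightarrow> 'a) \<Rightarrow> ('a::real_normed_vector \<Rightarrow> 'a \<Rightarrow> 'k::real_normed_field) \<Rightarrow>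
     'i set \<Rightarrow> 'i set \<Rightarrow> ('i \<Rightarrow> 'a) \<Rightarrow> ('i \<Rightarrow> 'a) \<Rightarrow> 'a \<Rightarrow> 'a"
  where "weaving_frame_op smul ip I \<sigma> \<phi> \<psi> f =
    partial_frame_op smul ip \<sigma> \<phi> f + partial_frame_op smul ip (I - \<sigma>) \<psi> f"

lemma separable_hilbert_space_real:
  assumes "\<exists>D::'a::{real_inner,banach} set. countable D \<and> closure D = UNIV"
  shows "separable_hilbert_space scaleR (inner :: 'a \<Rightarrow> 'a \<Rightarrow> real)"
  using assms
  by unfold_locales
    (simp_all add: conjg_real_def inner_commute inner_add_left inner_add_right power2_norm_eq_inner scaleR_add_right
      scaleR_add_left)

lemma separable_hilbert_space_complex:
  "separable_hilbert_space (*) (\<lambda>x y::complex. x * cnj y)"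
proof -
  obtain D :: "complex set" where "countable D" "closure D = UNIV"
    using separable[of "UNIV :: complex set"] by (metis top.extremum_uniqueI)
  then show ?thesis
    by unfold_locales
      (auto simp: conjg_complex_def algebra_simps scaleR_conv_of_real complex_norm_square
        simp del: of_real_power)
qed

end

theory Submission
  imports Defs
begin

text \<open>
  Let \<open>T\<^sub>1\<close> and \<open>T\<^sub>2\<close> be the partial frame operators over \<open>\<sigma>\<close> and its complement, \<open>S = T\<^sub>1 + T\<^sub>2\<close> and
  \<open>u = S\<^sup>-\<^sup>1 T\<^sub>1 f\<close>, so that \<open>f - u = S\<^sup>-\<^sup>1 T\<^sub>2 f\<close>. Since \<open>S\<close> is self-adjoint, the middle term equals
  \<open>\<langle>S u, u\<rangle> + \<langle>S (f - u), f - u\<rangle>\<close>. Its difference with the lower bound is \<open>2 \<langle>S h, h\<rangle>\<close> for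
  \<open>h = u - (\<lambda>/2) f\<close>. For the upper bound, \<open>\<langle>T\<^sub>1 (f - u), f - u\<rangle> \<ge> 0\<close> and \<open>S u = T\<^sub>1 f\<close> give
  \<open>\<langle>S u, u\<rangle> \<le> \<langle>T\<^sub>1 f, f\<rangle>\<close>, and symmetrically for \<open>T\<^sub>2\<close>.
\<close>

section \<open>Unconditional summability\<close>

text \<open>Cauchy criterion along the finite subsets of \<open>J\<close>: outside a large finite
  set \<open>g\<close> has a small total, hence so does the norm of any further finite sum of
  \<open>x\<close>.\<close>

lemma summable_on_square_norm_sum_le:
  fixes x :: "'i \<Rightarrow> 'a::banach" and g :: "'i \<Rightarrow> real"
  assumes B: "B \<ge> 0"
    and g: "g summable_on J" "\<And>i. i \<in> J \<Longrightarrow> g i \<ge> 0"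
    and le: "\<And>F. finite F \<Longrightarrow> F \<subseteq> J \<Longrightarrow> (norm (sum x F))\<^sup>2 \<le> B * sum g F"
  shows "x summable_on J"
proof -
  have "\<exists>P. eventually P (finite_subsets_at_top J) \<and>
          (\<forall>F F'. P F \<and> P F' \<longrightarrow> dist (sum x F) (sum x F') < e)" if "e > 0" for e
  proof -
    \<comment> \<open>The summand 1 keeps the denominator positive when \<open>B = 0\<close> and
      makes \<open>B * d\<close> strictly less than \<open>(e / 2)\<^sup>2\<close>.\<close>
    define d where "d = e\<^sup>2 / (4 * (B + 1))"
    have d: "d > 0" "B * d < (e / 2)\<^sup>2"
      using B \<open>e > 0\<close> by (simp_all add: d_def field_simps power2_eq_square)
    define P where "P F \<longleftrightarrow> finite F \<and> F \<subseteq> J \<and> infsum g J - d < sum g F" for F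
    have "(sum g \<longlongrightarrow> infsum g J) (finite_subsets_at_top J)"
      using has_sum_infsum[OF g(1)] by (simp add: has_sum_def)
    then have "eventually (\<lambda>F. infsum g J - d < sum g F) (finite_subsets_at_top J)"
      by (rule order_tendstoD) (use d in simp)
    then have evP: "eventually P (finite_subsets_at_top J)"
      unfolding P_def by (auto simp: eventually_conj_iff intro: eventually_finite_subsets_at_top_weakI)
    have half: "norm (sum x F - sum x F1) < e / 2"
      if "P F1" "F1 \<subseteq> F" "finite F" "F \<subseteq> J" for F F1
    proof -
      have "sum g (F - F1) = sum g F - sum g F1"
        using that by (simp add: sum_diff)
      also have "\<dots> \<le> d"
        using finite_sum_le_infsum[OF g(1) that(3,4)] g(2) that(1) by (auto simp: P_def)
      finally have "(norm (sum x (F - F1)))\<^sup>2 \<le> B * d"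
        using le[of "F - F1"] that mult_left_mono[OF _ B] by fastforce
      then have "(norm (sum x (F - F1)))\<^sup>2 < (e / 2)\<^sup>2"
        using d by linarith
      then have "norm (sum x (F - F1)) < e / 2"
        by (rule power2_less_imp_less) (use \<open>e > 0\<close> in simp)
      then show ?thesis
        using that by (simp add: sum_diff)
    qed
    \<comment> \<open>\<open>F1\<close> and \<open>F2\<close> need not be nested, so both are
      compared with their union.\<close>
    have "dist (sum x F1) (sum x F2) < e" if "P F1" "P F2" for F1 F2
    proof -
      have "norm (sum x (F1 \<union> F2) - sum x F1) < e / 2" "norm (sum x (F1 \<union> F2) - sum x F2) < e / 2"
        using half[OF that(1), of "F1 \<union> F2"] half[OF that(2), of "F1 \<union> F2"] that
        unfolding P_def by simp_all
      then show ?thesis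
        using dist_triangle3[of "sum x F1" "sum x F2" "sum x (F1 \<union> F2)"]
        by (simp add: dist_norm)
    qed
    with evP show ?thesis by blast
  qed
  then have "cauchy_filter (filtermap (sum x) (finite_subsets_at_top J))"
    by (simp add: cauchy_filter_metric_filtermap)
  then have "convergent_filter (filtermap (sum x) (finite_subsets_at_top J))"
    by (rule cauchy_filter_convergent)
  then show ?thesis
    by (auto simp: convergent_filter_iff summable_on_def has_sum_def filterlim_def)
qed

section \<open>Scalars and inner products\<close>

lemma mult_conjg_of_real: "x * conjg x = (of_real ((norm x)\<^sup>2) :: 'k::rc_field)"
  using mult_conjg[of x] by (simp only: scaleR_conv_of_real mult_1_right)

lemma conjg_one: "conjg (1::'k::rc_field) = 1"
  using mult_conjg[of "1::'k"] by simp

text \<open>A nonzero \<open>r\<close> cancels in \<open>r * conjg r = r * r\<close>; at 0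
  additivity of the conjugation decides.\<close>

lemma conjg_of_real: "conjg (of_real r :: 'k::rc_field) = of_real r"
proof (cases "r = 0")
  case True
  show ?thesis
    using conjg_add[of "0::'k" 0] True by simp
next
  case False
  have "(of_real r :: 'k) * conjg (of_real r) = of_real r * of_real r"
    using mult_conjg[of "of_real r :: 'k"] by (simp add: scaleR_conv_of_real power2_eq_square flip: of_real_mult)
  with False show ?thesis by simp
qed

lemma norm_conjg: "norm (conjg (x::'k::rc_field)) = norm x"
proof (cases "x = 0")
  case True
  then show ?thesis using conjg_of_real[of 0, where 'k = 'k] by simp
next
  case False
  have "norm x * norm (conjg x) = norm x * norm x"
    using arg_cong[OF mult_conjg[of x], of norm] by (simp add: norm_mult power2_eq_square)
  with False show ?thesis by simp
qed

lemma bounded_linear_conjg: "bounded_linear (conjg :: 'k::rc_field \<Rightarrow> 'k)"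
  by (rule bounded_linear_intro[of _ 1])
    (simp_all add: conjg_add conjg_mult conjg_of_real norm_conjg scaleR_conv_of_real)

text \<open>Both \<open>conjg x * conjg (conjg x)\<close> and \<open>conjg x * x\<close> equal the
  squared norm of \<open>x\<close>, and a nonzero \<open>conjg x\<close> cancels.\<close>

lemma conjg_conjg: "conjg (conjg x) = (x::'k::rc_field)"
proof (cases "x = 0")
  case True
  then show ?thesis using conjg_of_real[of 0, where 'k = 'k] by simp
next
  case False
  have "conjg x * conjg (conjg x) = conjg x * x"
    using mult_conjg[of x] mult_conjg[of "conjg x"] by (simp add: norm_conjg mult.commute)
  moreover have "conjg x \<noteq> 0"
    using False norm_conjg[of x] by auto
  ultimately show ?thesis by simp
qed

text \<open>The real part, by polarization, without distinguishing real and complex scalars.\<close>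

definition rpart :: "'k::rc_field \<Rightarrow> real"
  where "rpart x = ((norm (1 + x))\<^sup>2 - 1 - (norm x)\<^sup>2) / 2"

lemma of_real_rpart: "of_real (rpart x) = (x + conjg x) / (2::'k::rc_field)"
proof -
  have "of_real ((norm (1 + x))\<^sup>2) = (1 + x) * conjg (1 + x)"
    by (simp only: mult_conjg_of_real)
  also have "\<dots> = 1 + (x + conjg x) + x * conjg x"
    by (simp add: conjg_add conjg_one algebra_simps)
  also have "\<dots> = 1 + (x + conjg x) + of_real ((norm x)\<^sup>2)"
    by (simp only: mult_conjg_of_real)
  finally show ?thesis by (simp add: rpart_def)
qed

lemma rpart_eqI: "of_real r = (x + conjg x) / (2::'k::rc_field) \<Longrightarrow> rpart x = r"
  by (metis of_real_rpart of_real_eq_iff)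

lemma abs_rpart_le: "\<bar>rpart (x::'k::rc_field)\<bar> \<le> norm x"
proof -
  have "\<bar>rpart x\<bar> = norm ((x + conjg x) / 2)"
    by (metis of_real_rpart norm_of_real)
  also have "\<dots> \<le> norm x"
    using norm_triangle_ineq[of x "conjg x"] by (simp add: norm_divide norm_conjg)
  finally show ?thesis .
qed

text \<open>Real linearity and continuity let the real part pass through infinite sums.\<close>

lemma bounded_linear_rpart: "bounded_linear (rpart :: 'k::rc_field \<Rightarrow> real)"
proof (rule bounded_linear_intro[of _ 1])
  fix x y :: 'k and r :: real
  show "rpart (x + y) = rpart x + rpart y"
    by (rule rpart_eqI) (simp add: of_real_rpart conjg_add add_divide_distrib)
  show "rpart (r *\<^sub>R x) = r *\<^sub>R rpart x"
    by (rule rpart_eqI)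
      (simp add: of_real_rpart conjg_mult conjg_of_real scaleR_conv_of_real algebra_simps)
qed (simp add: abs_rpart_le)

lemma rpart_conjg: "rpart (conjg x) = rpart (x::'k::rc_field)"
  by (rule rpart_eqI) (simp add: of_real_rpart conjg_conjg add.commute)

lemma rpart_of_real: "rpart (of_real r :: 'k::rc_field) = r"
  by (rule rpart_eqI) (simp add: conjg_of_real)

section \<open>Norm identities and the Cauchy-Schwarz inequality\<close>

context separable_hilbert_space
begin

lemma ip_add_right: "ip z (x + y) = ip z x + ip z y"
  using ip_conjg[of z "x + y"] ip_conjg[of z x] ip_conjg[of z y] by (simp add: ip_add_left conjg_add)

lemma ip_scaleR_left: "ip (r *\<^sub>R x) y = r *\<^sub>R ip x y"
  by (metis ip_scale_left scaleR_conv_of_real scale_of_real)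

lemma ip_scaleR_right: "ip x (r *\<^sub>R y) = r *\<^sub>R ip x y"
  using ip_conjg[of x "r *\<^sub>R y"] ip_conjg[of x y]
  by (simp add: ip_scaleR_left scaleR_conv_of_real conjg_mult conjg_of_real)

lemma ip_diff_left: "ip (x - y) z = ip x z - ip y z"
  using ip_add_left[of "x - y" y z] by simp

lemma ip_diff_right: "ip z (x - y) = ip z x - ip z y"
  using ip_add_right[of z "x - y" y] by simp

text \<open>The locale ties the norm to scaling only for real scalars; the general case comes from
  evaluating \<open>ip\<close> at \<open>smul c x\<close>, which yields the factor
  \<open>c * conjg c\<close>.\<close>

lemma norm_smul: "norm (smul c x) = norm c * norm x"
proof -
  have "of_real ((norm (smul c x))\<^sup>2) = c * conjg c * ip x x"
    by (metis ip_self ip_scale_left ip_conjg conjg_mult mult.assoc conjg_conjg)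
  also have "\<dots> = of_real ((norm c * norm x)\<^sup>2)"
    by (simp add: mult_conjg_of_real ip_self power_mult_distrib)
  finally have "(norm (smul c x))\<^sup>2 = (norm c * norm x)\<^sup>2"
    using of_real_eq_iff by blast
  then show ?thesis by simp
qed

lemma norm_diff_square: "(norm (x - y))\<^sup>2 = (norm x)\<^sup>2 - 2 * rpart (ip x y) + (norm y)\<^sup>2"
proof -
  have "ip (x - y) (x - y) = ip x x - (ip x y + conjg (ip x y)) + ip y y"
    by (simp add: ip_diff_left ip_diff_right flip: ip_conjg)
  also have "ip x y + conjg (ip x y) = of_real (2 * rpart (ip x y))"
    by (simp add: of_real_rpart)
  finally have "of_real ((norm (x - y))\<^sup>2) = (of_real ((norm x)\<^sup>2 - 2 * rpart (ip x y) + (norm y)\<^sup>2) :: 'k)"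
    by (simp add: ip_self)
  then show ?thesis using of_real_eq_iff by blast
qed

text \<open>The triangle inequality is already part of the sort, so Cauchy-Schwarz is read off from
  the reverse triangle inequality after squaring.\<close>

lemma rpart_ip_le: "rpart (ip x y) \<le> norm x * norm y"
proof -
  have "(norm x - norm y)\<^sup>2 \<le> (norm (x - y))\<^sup>2"
    using norm_triangle_ineq3[of x y] by (simp add: abs_le_square_iff[symmetric])
  then show ?thesis
    by (simp add: norm_diff_square power2_diff)
qed

text \<open>Rotate \<open>x\<close> so that the inner product becomes nonnegative.\<close>

lemma norm_ip_le: "norm (ip x y) \<le> norm x * norm y"
proof (cases "ip x y = 0")
  case False
  have "(norm (ip x y))\<^sup>2 = rpart (ip x y * conjg (ip x y))"
    by (simp only: mult_conjg_of_real rpart_of_real)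
  also have "\<dots> = rpart (ip (smul (conjg (ip x y)) x) y)"
    by (simp add: ip_scale_left mult.commute)
  also have "\<dots> \<le> norm (ip x y) * (norm x * norm y)"
    using rpart_ip_le[of "smul (conjg (ip x y)) x" y] by (simp add: norm_smul norm_conjg mult.assoc)
  finally show ?thesis
    using False by (simp add: power2_eq_square)
qed simp

lemma bounded_bilinear_ip: "bounded_bilinear ip"
proof
  show "\<exists>K. \<forall>a b. norm (ip a b) \<le> norm a * norm b * K"
    using norm_ip_le by (intro exI[of _ 1]) simp
qed (simp_all add: ip_add_left ip_add_right ip_scaleR_left ip_scaleR_right)

lemma ip_commute_norm: "norm (ip x y) = norm (ip y x)"
  by (metis ip_conjg norm_conjg)

section \<open>Frame operators\<close>

text \<open>The upper half of the frame condition. Unlike the lower bound it survives restriction to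
  a subset of the index set, so it also covers the partial operators.\<close>

definition bessel :: "'i set \<Rightarrow> ('i \<Rightarrow> 'a) \<Rightarrow> real \<Rightarrow> bool"
  where "bessel J w B \<longleftrightarrow> B \<ge> 0 \<and>
    (\<forall>f. (\<lambda>i. (norm (ip f (w i)))\<^sup>2) summable_on J \<and>
         (\<Sum>\<^sub>\<infinity>i\<in>J. (norm (ip f (w i)))\<^sup>2) \<le> B * (norm f)\<^sup>2)"

lemma bessel_subset:
  assumes "bessel I w B" "J \<subseteq> I"
  shows "bessel J w B"
  unfolding bessel_def
proof (intro conjI allI)
  show "B \<ge> 0" using assms by (simp add: bessel_def)
  fix f
  have 1: "(\<lambda>i. (norm (ip f (w i)))\<^sup>2) summable_on I"
    "(\<Sum>\<^sub>\<infinity>i\<in>I. (norm (ip f (w i)))\<^sup>2) \<le> B * (norm f)\<^sup>2"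
    using assms by (auto simp: bessel_def)
  show 2: "(\<lambda>i. (norm (ip f (w i)))\<^sup>2) summable_on J"
    using 1(1) assms(2) by (rule summable_on_subset)
  show "(\<Sum>\<^sub>\<infinity>i\<in>J. (norm (ip f (w i)))\<^sup>2) \<le> B * (norm f)\<^sup>2"
    using infsum_mono2[OF 2 1(1) assms(2)] 1(2) by simp
qed

text \<open>Bound for the synthesis map by duality: pair the sum \<open>x\<close> with itself, apply
  Cauchy-Schwarz to the coefficients, use the Bessel bound at \<open>x\<close>, and divide by the
  squared norm of \<open>x\<close>.\<close>

lemma bessel_norm_sum_square_le:
  assumes w: "bessel J w B" and F: "finite F" "F \<subseteq> J"
  shows "(norm (\<Sum>i\<in>F. smul (c i) (w i)))\<^sup>2 \<le> B * (\<Sum>i\<in>F. (norm (c i))\<^sup>2)"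
proof (cases "(\<Sum>i\<in>F. smul (c i) (w i)) = 0")
  case True
  then show ?thesis using w by (simp add: bessel_def sum_nonneg)
next
  case False
  interpret ip: bounded_bilinear ip by (rule bounded_bilinear_ip)
  define x where "x = (\<Sum>i\<in>F. smul (c i) (w i))"
  have "(norm x)\<^sup>2 = norm (ip x x)"
    by (simp add: ip_self norm_power)
  also have "\<dots> = norm (\<Sum>i\<in>F. c i * ip (w i) x)"
    by (subst x_def) (simp add: ip.sum_left ip_scale_left)
  also have "\<dots> \<le> (\<Sum>i\<in>F. norm (c i) * norm (ip x (w i)))"
    by (rule order.trans[OF norm_sum]) (simp add: norm_mult ip_commute_norm)
  finally have "((norm x)\<^sup>2)\<^sup>2 \<le> (\<Sum>i\<in>F. norm (c i) * norm (ip x (w i)))\<^sup>2"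
    by (intro power_mono) auto
  also have "\<dots> \<le> (\<Sum>i\<in>F. (norm (c i))\<^sup>2) * (\<Sum>i\<in>F. (norm (ip x (w i)))\<^sup>2)"
    by (rule Cauchy_Schwarz_ineq_sum)
  also have "\<dots> \<le> (\<Sum>i\<in>F. (norm (c i))\<^sup>2) * (B * (norm x)\<^sup>2)"
  proof (rule mult_left_mono)
    have "(\<Sum>i\<in>F. (norm (ip x (w i)))\<^sup>2) \<le> (\<Sum>\<^sub>\<infinity>i\<in>J. (norm (ip x (w i)))\<^sup>2)"
      using w F by (intro finite_sum_le_infsum) (auto simp: bessel_def)
    also have "\<dots> \<le> B * (norm x)\<^sup>2"
      using w by (simp add: bessel_def)
    finally show "(\<Sum>i\<in>F. (norm (ip x (w i)))\<^sup>2) \<le> B * (norm x)\<^sup>2" .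
  qed (simp add: sum_nonneg)
  finally have "(norm x)\<^sup>2 * (norm x)\<^sup>2 \<le> (B * (\<Sum>i\<in>F. (norm (c i))\<^sup>2)) * (norm x)\<^sup>2"
    by (simp add: power2_eq_square mult_ac)
  then show ?thesis
    using False by (simp only: mult_le_cancel_right x_def) simp
qed

section \<open>Convergence, self-adjointness and linearity of frame operators\<close>

abbreviation frame_op where "frame_op J w \<equiv> partial_frame_op smul ip J w"

text \<open>The coefficients \<open>ip f (w i)\<close> are square summable, so the synthesis bound
  makes the series converge and \<open>infsum\<close> is its true value, not the default 0.\<close>

lemma frame_op_has_sum:
  assumes w: "bessel J w B"
  shows "((\<lambda>i. smul (ip f (w i)) (w i)) has_sum frame_op J w f) J"
  unfolding partial_frame_op_def
proof (rule has_sum_infsum, rule summable_on_square_norm_sum_le)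
  show "B \<ge> 0" "(\<lambda>i. (norm (ip f (w i)))\<^sup>2) summable_on J"
    using w by (auto simp: bessel_def)
qed (auto intro: bessel_norm_sum_square_le[OF w])

lemma ip_frame_op_has_sum:
  assumes w: "bessel J w B"
  shows "((\<lambda>i. ip f (w i) * conjg (ip g (w i))) has_sum ip (frame_op J w f) g) J"
proof -
  have "((\<lambda>i. ip (smul (ip f (w i)) (w i)) g) has_sum ip (frame_op J w f) g) J"
    by (rule has_sum_bounded_linear[OF bounded_bilinear.bounded_linear_left[OF bounded_bilinear_ip]
          frame_op_has_sum[OF w]])
  then show ?thesis
    by (simp add: ip_scale_left flip: ip_conjg)
qed

text \<open>Both sides are sums of one series: conjugating the expansion with \<open>f\<close> and
  \<open>g\<close> exchanged gives back the same terms.\<close>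

lemma frame_op_selfadjoint:
  assumes w: "bessel J w B"
  shows "ip (frame_op J w f) g = ip f (frame_op J w g)"
proof (rule has_sum_unique[OF ip_frame_op_has_sum[OF w]])
  have "((\<lambda>i. conjg (ip g (w i) * conjg (ip f (w i)))) has_sum conjg (ip (frame_op J w g) f)) J"
    by (rule has_sum_bounded_linear[OF bounded_linear_conjg ip_frame_op_has_sum[OF w]])
  then show "((\<lambda>i. ip f (w i) * conjg (ip g (w i))) has_sum ip f (frame_op J w g)) J"
    by (simp add: conjg_mult conjg_conjg mult.commute flip: ip_conjg)
qed

lemma linear_frame_op:
  assumes w: "bessel J w B"
  shows "linear (frame_op J w)"
proof
  fix f g and r :: real
  show "frame_op J w (f + g) = frame_op J w f + frame_op J w g"
    using has_sum_add[OF frame_op_has_sum[OF w, of f] frame_op_has_sum[OF w, of g]]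
      has_sum_unique[OF frame_op_has_sum[OF w, of "f + g"]]
    by (simp add: ip_add_left scale_left_distrib)
  have "smul (ip (r *\<^sub>R f) (w i)) (w i) = r *\<^sub>R smul (ip f (w i)) (w i)" for i
    by (simp only: ip_scale_left scale_scale flip: scale_of_real)
  then show "frame_op J w (r *\<^sub>R f) = r *\<^sub>R frame_op J w f"
    using has_sum_bounded_linear[OF bounded_linear_scaleR_right frame_op_has_sum[OF w, of f], of r]
      has_sum_unique[OF frame_op_has_sum[OF w, of "r *\<^sub>R f"]]
    by simp
qed

text \<open>The underlying real inner product. It induces the same norm, so quadratic forms can be
  handled over the reals for both scalar fields.\<close>

definition rip :: "'a \<Rightarrow> 'a \<Rightarrow> real" where "rip x y = rpart (ip x y)"

lemma bounded_bilinear_rip: "bounded_bilinear rip"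
proof
  interpret ip: bounded_bilinear ip by (rule bounded_bilinear_ip)
  interpret rpart: bounded_linear "rpart :: 'k \<Rightarrow> real" by (rule bounded_linear_rpart)
  show "rip (x + x') y = rip x y + rip x' y" "rip x (y + y') = rip x y + rip x y'"
    "rip (r *\<^sub>R x) y = r *\<^sub>R rip x y" "rip x (r *\<^sub>R y) = r *\<^sub>R rip x y" for x x' y y' r
    by (simp_all add: rip_def ip.add_left ip.add_right ip.scaleR_left ip.scaleR_right
        rpart.add rpart.scaleR)
  show "\<exists>K. \<forall>x y. norm (rip x y) \<le> norm x * norm y * K"
    using order.trans[OF abs_rpart_le norm_ip_le] by (intro exI[of _ 1]) (simp add: rip_def)
qed

lemma rip_commute: "rip x y = rip y x"
  by (metis rip_def ip_conjg rpart_conjg)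

lemma rip_self: "rip x x = (norm x)\<^sup>2"
  by (simp only: rip_def ip_self rpart_of_real)

text \<open>Turns the sums of the inequality into quadratic forms of partial frame
  operators.\<close>

lemma rip_frame_op_self:
  assumes w: "bessel J w B"
  shows "rip (frame_op J w f) f = (\<Sum>\<^sub>\<infinity>i\<in>J. (norm (ip f (w i)))\<^sup>2)"
proof -
  have "((\<lambda>i. rpart (ip f (w i) * conjg (ip f (w i)))) has_sum rip (frame_op J w f) f) J"
    unfolding rip_def
    by (rule has_sum_bounded_linear[OF bounded_linear_rpart ip_frame_op_has_sum[OF w]])
  then show ?thesis
    by (simp only: mult_conjg_of_real rpart_of_real infsumI)
qed

lemma rip_frame_op_nonneg: "bessel J w B \<Longrightarrow> rip (frame_op J w f) f \<ge> 0"
  by (simp add: rip_frame_op_self infsum_nonneg)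

text \<open>Positivity of the frame operator at \<open>B f - T f\<close>.\<close>

lemma norm_frame_op_le:
  assumes w: "bessel J w B"
  shows "(norm (frame_op J w f))\<^sup>2 \<le> B\<^sup>2 * (norm f)\<^sup>2"
proof (cases "B = 0")
  \<comment> \<open>The main argument cancels a factor \<open>B\<close>; for \<open>B = 0\<close>
    every term of the series vanishes.\<close>
  case True
  have "smul (ip f (w i)) (w i) = 0" if "i \<in> J" for i
  proof -
    have "(norm (ip f (w i)))\<^sup>2 \<le> (\<Sum>\<^sub>\<infinity>i\<in>J. (norm (ip f (w i)))\<^sup>2)"
      using finite_sum_le_infsum[of "\<lambda>i. (norm (ip f (w i)))\<^sup>2" J "{i}"] w that
      by (auto simp: bessel_def)
    also have "\<dots> \<le> 0"
      using w True by (simp add: bessel_def)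
    finally show ?thesis by simp
  qed
  then have "frame_op J w f = 0"
    unfolding partial_frame_op_def by (simp add: infsum_0)
  then show ?thesis by simp
next
  case False
  interpret rip: bounded_bilinear rip by (rule bounded_bilinear_rip)
  interpret T: linear "frame_op J w" by (rule linear_frame_op[OF w])
  let ?T = "frame_op J w"
  have B: "B > 0" using w False by (simp add: bessel_def)
  have adj: "rip (?T x) y = rip x (?T y)" for x y
    by (simp add: rip_def frame_op_selfadjoint[OF w])
  have q: "rip (?T x) x \<le> B * (norm x)\<^sup>2" for x
    using w by (simp add: rip_frame_op_self[OF w] bessel_def)
  have "0 \<le> rip (?T (B *\<^sub>R f - ?T f)) (B *\<^sub>R f - ?T f)"
    by (rule rip_frame_op_nonneg[OF w])
  also have "\<dots> = B\<^sup>2 * rip (?T f) f - 2 * B * (norm (?T f))\<^sup>2 + rip (?T (?T f)) (?T f)"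
    by (simp add: T.diff T.scale rip.diff_left rip.diff_right rip.scaleR_left rip.scaleR_right
        adj[of "?T f" f] rip_self power2_eq_square algebra_simps)
  \<comment> \<open>The upper bound \<open>q\<close> is used twice, at \<open>f\<close> and at
    \<open>?T f\<close>; the latter absorbs half of the negative term.\<close>
  also have "\<dots> \<le> B\<^sup>2 * (B * (norm f)\<^sup>2) - B * (norm (?T f))\<^sup>2"
    using q[of "?T f"] mult_left_mono[OF q[of f], of "B\<^sup>2"] by simp
  finally have "B * (norm (?T f))\<^sup>2 \<le> B * (B\<^sup>2 * (norm f)\<^sup>2)"
    by (simp add: algebra_simps)
  then show ?thesis using B by simp
qed

section \<open>Surjectivity of the frame operator\<close>

lemma frame_bessel: "frame_with_bounds ip I w A B \<Longrightarrow> bessel I w B"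
  by (auto simp: frame_with_bounds_def bessel_def)

text \<open>For \<open>t = A / B\<^sup>2\<close> the map \<open>x \<mapsto> x - t (S x - y)\<close> is a contraction.\<close>

lemma surj_frame_op:
  assumes fr: "frame_with_bounds ip I w A B"
  shows "surj (frame_op I w)"
  unfolding surj_def
proof
  fix y
  note w = frame_bessel[OF fr]
  interpret rip: bounded_bilinear rip by (rule bounded_bilinear_rip)
  interpret T: linear "frame_op I w" by (rule linear_frame_op[OF w])
  let ?T = "frame_op I w"
  have AB: "A > 0" "B > 0"
    using fr by (auto simp: frame_with_bounds_def)
  \<comment> \<open>This \<open>t\<close> minimizes
    \<open>1 - 2 * t * A + t\<^sup>2 * B\<^sup>2\<close>, with minimum
    \<open>1 - A\<^sup>2 / B\<^sup>2\<close>.\<close>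
  define t where "t = A / B\<^sup>2"
  have t: "t > 0" using AB by (simp add: t_def)
  \<comment> \<open>In the zero space \<open>A\<close> may exceed \<open>B\<close>;
    \<open>max 0\<close> keeps the radicand nonnegative there.\<close>
  define c where "c = sqrt (max 0 (1 - A\<^sup>2 / B\<^sup>2))"
  have c: "0 \<le> c" "c < 1"
    using AB by (auto simp: c_def real_sqrt_lt_1_iff)
  have contr: "norm (x - t *\<^sub>R ?T x) \<le> c * norm x" for x
  proof (rule power2_le_imp_le)
    have low: "A * (norm x)\<^sup>2 \<le> rip (?T x) x"
      using fr by (simp add: rip_frame_op_self[OF w] frame_with_bounds_def)
    have "(norm (x - t *\<^sub>R ?T x))\<^sup>2 = (norm x)\<^sup>2 - 2 * t * rip (?T x) x + t\<^sup>2 * (norm (?T x))\<^sup>2"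
      using rip.scaleR_right[of x t "?T x"]
      by (simp add: norm_diff_square power_mult_distrib rip_commute[of "?T x"] flip: rip_def)
    also have "\<dots> \<le> (norm x)\<^sup>2 - 2 * t * (A * (norm x)\<^sup>2) + t\<^sup>2 * (B\<^sup>2 * (norm x)\<^sup>2)"
      using norm_frame_op_le[OF w, of x] low t by (intro add_mono diff_mono mult_left_mono) auto
    also have "\<dots> = (1 - A\<^sup>2 / B\<^sup>2) * (norm x)\<^sup>2"
      using AB by (simp add: t_def field_simps power2_eq_square)
    also have "\<dots> \<le> c\<^sup>2 * (norm x)\<^sup>2"
      by (intro mult_right_mono) (auto simp: c_def)
    finally show "(norm (x - t *\<^sub>R ?T x))\<^sup>2 \<le> (c * norm x)\<^sup>2"
      by (simp add: power_mult_distrib)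
  qed (use c in simp)
  have "\<exists>!x. x - t *\<^sub>R (?T x - y) = x"
  proof (rule banach_fix_type[OF c], intro allI)
    fix x z
    show "dist (x - t *\<^sub>R (?T x - y)) (z - t *\<^sub>R (?T z - y)) \<le> c * dist x z"
      using contr[of "x - z"] by (simp add: dist_norm T.diff algebra_simps)
  qed
  \<comment> \<open>At the fixed point \<open>t *\<^sub>R (?T x - y)\<close> vanishes, and
    \<open>t > 0\<close>.\<close>
  then obtain x where "x - t *\<^sub>R (?T x - y) = x" by blast
  then show "\<exists>x. y = ?T x" using t by auto
qed

section \<open>Splitting one frame along a subset, and the two inequalities\<close>

lemma frame_op_split:
  assumes w: "bessel I w B" and "\<sigma> \<subseteq> I"
  shows "frame_op I w f = frame_op \<sigma> w f + frame_op (I - \<sigma>) w f"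
proof (rule has_sum_unique[OF frame_op_has_sum[OF w, of f]])
  have "((\<lambda>i. smul (ip f (w i)) (w i)) has_sum frame_op \<sigma> w f + frame_op (I - \<sigma>) w f) (\<sigma> \<union> (I - \<sigma>))"
    using assms(2) bessel_subset[OF w]
    by (intro has_sum_Un_disjoint frame_op_has_sum[where B = B]) auto
  then show "((\<lambda>i. smul (ip f (w i)) (w i)) has_sum frame_op \<sigma> w f + frame_op (I - \<sigma>) w f) I"
    using assms(2) by (simp add: Un_absorb1)
qed

text \<open>Moving \<open>S\<close> across the inner product cancels \<open>inv S\<close>, a right
  inverse since \<open>S\<close> is onto; what remains are the coefficients
  \<open>ip u (w i)\<close>.\<close>

lemma infsum_ip_inv_frame_op:
  assumes fr: "frame_with_bounds ip I w A B" and "\<sigma> \<subseteq> I"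
  defines "S \<equiv> frame_op I w"
  shows "(\<Sum>\<^sub>\<infinity>i\<in>\<sigma>. (norm (ip (S u) (inv S (w i))))\<^sup>2) +
         (\<Sum>\<^sub>\<infinity>i\<in>I - \<sigma>. (norm (ip (S u) (inv S (w i))))\<^sup>2) = rip (S u) u"
proof -
  note w = frame_bessel[OF fr]
  interpret rip: bounded_bilinear rip by (rule bounded_bilinear_rip)
  have "ip (S u) (inv S x) = ip u x" for x
    using surj_f_inv_f[OF surj_frame_op[OF fr]] by (simp add: S_def frame_op_selfadjoint[OF w])
  then show ?thesis
    using rip_frame_op_self[OF bessel_subset[OF w assms(2)], of u]
      rip_frame_op_self[OF bessel_subset[OF w Diff_subset], of \<sigma> u]
      frame_op_split[OF w assms(2), of u]
    by (simp add: rip.add_left flip: S_def)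
qed

text \<open>Kept general in the subset, so that it serves both for \<open>\<sigma>\<close> with
  \<open>u\<close> and for \<open>I - \<sigma>\<close> with \<open>f - u\<close>.\<close>

lemma rip_frame_op_preimage_le:
  assumes fr: "frame_with_bounds ip I w A B" and \<sigma>: "\<sigma> \<subseteq> I"
    and u: "frame_op I w u = frame_op \<sigma> w f"
  shows "rip (frame_op I w u) u \<le> rip (frame_op \<sigma> w f) f"
proof -
  note w = frame_bessel[OF fr]
  note w' = bessel_subset[OF w]
  interpret rip: bounded_bilinear rip by (rule bounded_bilinear_rip)
  interpret T: linear "frame_op \<sigma> w" by (rule linear_frame_op[OF w'[OF \<sigma>]])
  have adj: "rip (frame_op \<sigma> w u) f = rip (frame_op \<sigma> w f) u"
    by (metis rip_def frame_op_selfadjoint[OF w'[OF \<sigma>]] rip_commute)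
  have "0 \<le> rip (frame_op \<sigma> w (f - u)) (f - u)"
    by (rule rip_frame_op_nonneg[OF w'[OF \<sigma>]])
  also have "\<dots> = rip (frame_op \<sigma> w f) f - 2 * rip (frame_op I w u) u + rip (frame_op \<sigma> w u) u"
    by (simp add: T.diff rip.diff_left rip.diff_right adj u)
  \<comment> \<open>The complementary partial operator is positive, so the form over
    \<open>\<sigma>\<close> is dominated by the full one.\<close>
  also have "rip (frame_op \<sigma> w u) u \<le> rip (frame_op I w u) u"
    using rip_frame_op_nonneg[OF w'[of "I - \<sigma>"], of u]
    by (simp add: frame_op_split[OF w \<sigma>] rip.add_left)
  finally show ?thesis by simp
qed

lemma frame_inequality:
  fixes f :: 'a and l :: real
  assumes fr: "frame_with_bounds ip I w A B" and \<sigma>: "\<sigma> \<subseteq> I"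
  defines "S \<equiv> frame_op I w" and "T1 \<equiv> frame_op \<sigma> w" and "T2 \<equiv> frame_op (I - \<sigma>) w"
  defines "M \<equiv> (\<Sum>\<^sub>\<infinity>i\<in>\<sigma>. (norm (ip (T1 f) (inv S (w i))))\<^sup>2)
               + (\<Sum>\<^sub>\<infinity>i\<in>I - \<sigma>. (norm (ip (T1 f) (inv S (w i))))\<^sup>2)
               + (\<Sum>\<^sub>\<infinity>i\<in>\<sigma>. (norm (ip (T2 f) (inv S (w i))))\<^sup>2)
               + (\<Sum>\<^sub>\<infinity>i\<in>I - \<sigma>. (norm (ip (T2 f) (inv S (w i))))\<^sup>2)"
  shows "(2 * l - l\<^sup>2 / 2 - 1) * (\<Sum>\<^sub>\<infinity>i\<in>\<sigma>. (norm (ip f (w i)))\<^sup>2)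
           + (1 - l\<^sup>2 / 2) * (\<Sum>\<^sub>\<infinity>i\<in>I - \<sigma>. (norm (ip f (w i)))\<^sup>2) \<le> M" (is ?lower)
    and "M \<le> (\<Sum>\<^sub>\<infinity>i\<in>\<sigma>. (norm (ip f (w i)))\<^sup>2) + (\<Sum>\<^sub>\<infinity>i\<in>I - \<sigma>. (norm (ip f (w i)))\<^sup>2)" (is ?upper)
proof -
  note w = frame_bessel[OF fr]
  note w' = bessel_subset[OF w]
  interpret rip: bounded_bilinear rip by (rule bounded_bilinear_rip)
  interpret S: linear S unfolding S_def by (rule linear_frame_op[OF w])
  have split: "S x = T1 x + T2 x" for x
    by (simp add: S_def T1_def T2_def frame_op_split[OF w \<sigma>])
  have q: "(\<Sum>\<^sub>\<infinity>i\<in>\<sigma>. (norm (ip f (w i)))\<^sup>2) = rip (T1 f) f"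
    "(\<Sum>\<^sub>\<infinity>i\<in>I - \<sigma>. (norm (ip f (w i)))\<^sup>2) = rip (T2 f) f"
    unfolding T1_def T2_def using rip_frame_op_self[OF w'] \<sigma> by simp_all
  define u where "u = inv S (T1 f)"
  have u: "S u = T1 f"
    unfolding u_def S_def by (rule surj_f_inv_f[OF surj_frame_op[OF fr]])
  then have v: "S (f - u) = T2 f"
    using split[of f] by (simp add: S.diff)
  have M: "M = rip (S u) u + rip (S (f - u)) (f - u)"
    using infsum_ip_inv_frame_op[OF fr \<sigma>, of u] infsum_ip_inv_frame_op[OF fr \<sigma>, of "f - u"]
    unfolding M_def S_def[symmetric] u v by simp
  show ?upper
    using rip_frame_op_preimage_le[OF fr \<sigma>, of u f] rip_frame_op_preimage_le[OF fr, of "I - \<sigma>" "f - u" f] u v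
    unfolding M q by (simp add: S_def T1_def T2_def)
  have adj: "rip (S f) u = rip (S u) f"
    by (metis rip_def S_def frame_op_selfadjoint[OF w] rip_commute)
  have "0 \<le> rip (S (u - (l / 2) *\<^sub>R f)) (u - (l / 2) *\<^sub>R f)"
    unfolding S_def by (rule rip_frame_op_nonneg[OF w])
  also have "\<dots> = rip (S u) u - l * rip (S u) f + l\<^sup>2 / 4 * rip (S f) f"
    by (simp add: S.diff S.scale rip.diff_left rip.diff_right rip.scaleR_left rip.scaleR_right
        adj power2_eq_square algebra_simps)
  finally have pos: "0 \<le> 2 * rip (S u) u - 2 * l * rip (T1 f) f + l\<^sup>2 / 2 * rip (S f) f"
    by (simp add: u)
  have "M = 2 * rip (S u) u - 2 * rip (T1 f) f + rip (S f) f"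
    unfolding M by (simp add: S.diff rip.diff_left rip.diff_right adj flip: u)
  \<comment> \<open>Inserting \<open>pos\<close> leaves forms in \<open>T1\<close> and
    \<open>S\<close> at \<open>f\<close>; writing \<open>S\<close> as \<open>T1 + T2\<close>
    produces the two stated coefficients.\<close>
  with pos show ?lower
    unfolding q by (simp add: split rip.add_left algebra_simps)
qed

end

section \<open>Transfer from a single frame to woven frames\<close>

theorem theorem15:
  fixes smul :: "'k::rc_field \<Rightarrow> 'a::banach \<Rightarrow> 'a"
    and ip :: "'a \<Rightarrow> 'a \<Rightarrow> 'k"
    and I \<sigma> :: "'i set"
    and \<phi> \<psi> :: "'i \<Rightarrow> 'a"
    and l :: real
    and f :: 'a
  assumes "separable_hilbert_space smul ip"
    and "countable I"
    and "woven_frames ip I \<phi> \<psi>"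
    and "\<sigma> \<subseteq> I"
  shows "let S1 = partial_frame_op smul ip \<sigma> \<phi>;
             S2 = partial_frame_op smul ip (I - \<sigma>) \<psi>;
             Sinv = inv (weaving_frame_op smul ip I \<sigma> \<phi> \<psi>);
             M = (\<Sum>\<^sub>\<infinity>i\<in>\<sigma>. (norm (ip (S1 f) (Sinv (\<phi> i))))\<^sup>2)
               + (\<Sum>\<^sub>\<infinity>i\<in>I - \<sigma>. (norm (ip (S1 f) (Sinv (\<psi> i))))\<^sup>2)
               + (\<Sum>\<^sub>\<infinity>i\<in>\<sigma>. (norm (ip (S2 f) (Sinv (\<phi> i))))\<^sup>2)
               + (\<Sum>\<^sub>\<infinity>i\<in>I - \<sigma>. (norm (ip (S2 f) (Sinv (\<psi> i))))\<^sup>2)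
         in (2 * l - l\<^sup>2 / 2 - 1) * (\<Sum>\<^sub>\<infinity>i\<in>\<sigma>. (norm (ip f (\<phi> i)))\<^sup>2)
              + (1 - l\<^sup>2 / 2) * (\<Sum>\<^sub>\<infinity>i\<in>I - \<sigma>. (norm (ip f (\<psi> i)))\<^sup>2) \<le> M
          \<and> M \<le> (\<Sum>\<^sub>\<infinity>i\<in>\<sigma>. (norm (ip f (\<phi> i)))\<^sup>2)
                + (\<Sum>\<^sub>\<infinity>i\<in>I - \<sigma>. (norm (ip f (\<psi> i)))\<^sup>2)"
proof -
  interpret separable_hilbert_space smul ip by fact
  \<comment> \<open>The weaving agrees with \<open>\<phi>\<close> on \<open>\<sigma>\<close> and
    with \<open>\<psi>\<close> on \<open>I - \<sigma>\<close>, so every operator and sum can be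
    rewritten in terms of the one frame \<open>w\<close>.\<close>
  define w where "w = weaving \<sigma> \<phi> \<psi>"
  obtain A B where fr: "frame_with_bounds ip I w A B"
    using assms(3,4) by (auto simp: woven_frames_def w_def)
  have ops: "partial_frame_op smul ip \<sigma> \<phi> = frame_op \<sigma> w"
    "partial_frame_op smul ip (I - \<sigma>) \<psi> = frame_op (I - \<sigma>) w"
    by (intro ext; auto simp: partial_frame_op_def w_def weaving_def intro!: infsum_cong)+
  have S: "weaving_frame_op smul ip I \<sigma> \<phi> \<psi> = frame_op I w"
    by (simp add: fun_eq_iff weaving_frame_op_def ops frame_op_split[OF frame_bessel[OF fr] assms(4)])
  have sums: "(\<Sum>\<^sub>\<infinity>i\<in>\<sigma>. h (\<phi> i)) = (\<Sum>\<^sub>\<infinity>i\<in>\<sigma>. h (w i))"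
    "(\<Sum>\<^sub>\<infinity>i\<in>I - \<sigma>. h (\<psi> i)) = (\<Sum>\<^sub>\<infinity>i\<in>I - \<sigma>. h (w i))" for h :: "'a \<Rightarrow> real"
    by (auto simp: w_def weaving_def intro!: infsum_cong)
  show ?thesis
    unfolding Let_def ops S
      sums[of "\<lambda>x. (norm (ip f x))\<^sup>2"] sums[of "\<lambda>x. (norm (ip (frame_op J w f) (inv (frame_op I w) x)))\<^sup>2" for J]
    using frame_inequality(1)[OF fr assms(4), where l = l and f = f]
      frame_inequality(2)[OF fr assms(4), where f = f] by blast
qed

end
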